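(* Let $n\ge 1$, let $\alpha_1,\ldots,\alpha_n\in\mathbb{C}$ be algebraic numbers, and let $S=\mathbb{N}_0[\alpha_1,\ldots,\alpha_n]\subseteq\mathbb{C}$. If $S$ is bi-UFS, then $S$ is either an integral domain (i.e. a subring of $\mathbb{C}$) or isomorphic as a semiring to $\mathbb{N}_0$.
   Context: $\mathbb{N}_0$ denotes the nonnegative integers and $\mathbb{N}_0[\alpha_1,\ldots,\alpha_n]=\{f(\alpha_1,\ldots,\alpha_n): f\in\mathbb{N}_0[x_1,\ldots,x_n]\}$. Put $S^*=S\setminus\{0\}$. All monoids are commutative and cancellative. A nonunit $a$ of a monoid $M$ is an atom if $a=xy$ with $x,y\in M$ forces $x$ or $y$ to be a unit. A monoid is a unique factorization monoid (UFM) if every nonunit factors into finitely many atoms, uniquely up to order and multiplication by units (equivalently, after passing to the quotient by the group of units). $S$ is bi-UFS if both $(S,+)$ and $(S^*,\cdot)$ are UFMs. A semiring isomorphism is a bijection preserving addition, multiplication, $0$ and $1$. *)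

theory Defs
  imports
    Complex_Main
    "HOL-Library.Poly_Mapping"
    "HOL-Algebra.QuotRing"
    "HOL-Algebra.Ring_Divisibility"
    "HOL-Computational_Algebra.Polynomial"
begin

text \<open>
  A multivariate polynomial over the nonnegative integers is a finitely supported map from
  monomials to coefficients, a monomial being a finitely supported map from variable indices
  to exponents.
\<close>

type_synonym nat_mpoly = "(nat \<Rightarrow>\<^sub>0 nat) \<Rightarrow>\<^sub>0 nat"

definition mpoly_vars :: "nat_mpoly \<Rightarrow> nat set" where
  "mpoly_vars f = (\<Union>m\<in>Poly_Mapping.keys f. Poly_Mapping.keys m)"

definition mpoly_eval :: "(nat \<Rightarrow> complex) \<Rightarrow> nat_mpoly \<Rightarrow> complex" where
  "mpoly_eval \<alpha> f = (\<Sum>m\<in>Poly_Mapping.keys f. of_nat (Poly_Mapping.lookup f m) * (\<Prod>i\<in>Poly_Mapping.keys m. \<alpha> i ^ Poly_Mapping.lookup m i))"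

definition N0_adjoin :: "nat \<Rightarrow> (nat \<Rightarrow> complex) \<Rightarrow> complex set" where
  "N0_adjoin n \<alpha> = {mpoly_eval \<alpha> f | f. mpoly_vars f \<subseteq> {1..n}}"

text \<open>
  Semirings are represented by ring records, whose record type does not presuppose additive
  inverses.
\<close>

definition complex_subsemiring :: "complex set \<Rightarrow> complex ring" where
  "complex_subsemiring S = \<lparr>carrier = S, mult = (*), one = 1, zero = 0, add = (+)\<rparr>"

definition nat_semiring :: "nat ring" where
  "nat_semiring = \<lparr>carrier = UNIV, mult = (*), one = 1, zero = 0, add = (+)\<rparr>"

text \<open>
  \<^const>\<open>factorial_monoid\<close> includes commutativity and cancellativity; its atoms are defined
  through proper factors, which agrees with the definition by products in cancellative
  commutative monoids.
\<close>

definition bi_UFS :: "('a, 'm) ring_scheme \<Rightarrow> bool" where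
  "bi_UFS R \<longleftrightarrow> factorial_monoid (add_monoid R) \<and> factorial_monoid (mult_of R)"

text \<open>
  \<^const>\<open>ring_iso\<close> does not ask for preservation of zero, so this is added explicitly.
\<close>

definition semiring_isomorphic :: "('a, 'm) ring_scheme \<Rightarrow> ('b, 'n) ring_scheme \<Rightarrow> bool" where
  "semiring_isomorphic R T \<longleftrightarrow> (\<exists>h \<in> ring_iso R T. h \<zero>\<^bsub>R\<^esub> = \<zero>\<^bsub>T\<^esub>)"

end

theory Submission
  imports Defs
begin

text \<open>
  Write \<open>x \<sqsubseteq> f\<close> if some multiple \<open>N f\<close> satisfies \<open>N f - x \<in> S\<close>, and call \<open>f \<in> S\<close> an order unit if
  \<open>x \<sqsubseteq> f\<close> for all \<open>x \<in> S\<close>.  The heart of the proof is that unique factorization in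
  \<open>S - {0}\<close> forces \<^emph>\<open>every\<close> nonzero element of \<open>S\<close> to be an order unit.

  Algebraicity of the generators gives two things.  Solving an integer equation for its leading
  term bounds high powers of a generator by low ones, which yields an order unit \<open>u\<close>
  (\<open>ex_order_unit\<close>).  And every nonzero \<open>a \<in> S\<close>, being algebraic itself, divides a positive
  integer in the ring of differences of \<open>S\<close> (\<open>algebraic_divides_integer\<close>), so that a product of
  an order unit with a nonzero element is again an order unit (\<open>order_unit_mult\<close>).

  Now let \<open>f \<noteq> 0\<close>.  If \<open>u = 0\<close>, then \<open>S\<close> is closed under negation and \<open>f\<close> is trivially an order
  unit.  Otherwise \<open>f u\<close> is an order unit, and \<open>u\<close> is a product of prime elements, up to a
  multiplicative unit; it thus suffices to cancel one prime \<open>p\<close>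
  (\<open>order_unit_cancel_prime\<close>).  Let \<open>p f\<close> be an order unit, but suppose \<open>N f - b \<notin> S\<close> for all
  \<open>N\<close>.  For large \<open>L\<close> the difference \<open>d = L f - b\<close> is not in \<open>S\<close>, but \<open>p d\<close> is, as \<open>p f\<close> is an
  order unit, and so is \<open>p d\<^sup>2 = L\<^sup>2 (p f\<^sup>2) - 2 L (p f b) + p b\<^sup>2\<close>, as \<open>p f\<^sup>2\<close> is an order unit.
  So \<open>p\<close> divides \<open>(p d)\<^sup>2 = p (p d\<^sup>2)\<close> in \<open>S\<close> and hence divides \<open>p d\<close>, which puts \<open>d\<close> into \<open>S\<close>:
  a contradiction.

  If \<open>-1 \<in> S\<close>, then \<open>S\<close> is a ring.  Otherwise \<open>0\<close> is the only additive unit, because a nonzero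
  \<open>x\<close> with \<open>-x \<in> S\<close> would be an order unit and make \<open>-1 = (N x - 1) + N (-x)\<close> an element.
  Let \<open>a\<close> be an additive atom.  As \<open>a\<close> is an order unit, each \<open>x \<in> S\<close> is a summand of a multiple
  \<open>N a\<close>, and additive unique factorization makes \<open>x\<close> itself a multiple of \<open>a\<close>.  So \<open>S\<close> consists
  of the multiples of \<open>a\<close>, and then \<open>1 = n a\<close> and \<open>a\<^sup>2 = m a\<close> force \<open>a = 1\<close>.
\<close>

section \<open>Order units of subsemirings\<close>

locale subsemiring =
  fixes S :: "'a::idom set"
  assumes zero_mem: "0 \<in> S" and one_mem: "1 \<in> S"
    and add_mem: "x \<in> S \<Longrightarrow> y \<in> S \<Longrightarrow> x + y \<in> S"
    and mult_mem: "x \<in> S \<Longrightarrow> y \<in> S \<Longrightarrow> x * y \<in> S"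
begin

definition order_unit :: "'a \<Rightarrow> bool" where
  "order_unit f \<longleftrightarrow> f \<in> S \<and> (\<forall>x\<in>S. \<exists>N. of_nat N * f - x \<in> S)"

lemma of_nat_mem: "of_nat N \<in> S"
  by (induction N) (auto intro: zero_mem one_mem add_mem)

lemma power_mem: "x \<in> S \<Longrightarrow> x ^ n \<in> S"
  by (induction n) (auto intro: one_mem mult_mem)

lemma sum_mem: "(\<And>i. i \<in> I \<Longrightarrow> f i \<in> S) \<Longrightarrow> sum f I \<in> S"
  by (induction I rule: infinite_finite_induct) (auto intro: zero_mem add_mem)

lemma prod_mem: "(\<And>i. i \<in> I \<Longrightarrow> f i \<in> S) \<Longrightarrow> prod f I \<in> S"
  by (induction I rule: infinite_finite_induct) (auto intro: one_mem mult_mem)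

lemma multiple_dominates_mono:
  assumes "of_nat N * f - x \<in> S" "f \<in> S" "N \<le> M"
  shows "of_nat M * f - x \<in> S"
proof -
  have "of_nat M * f - x = of_nat (M - N) * f + (of_nat N * f - x)"
    using \<open>N \<le> M\<close> by (simp add: of_nat_diff algebra_simps)
  moreover have "\<dots> \<in> S"
    using assms by (intro add_mem mult_mem of_nat_mem)
  ultimately show ?thesis by (simp only:)
qed

end

text \<open>
  Divisibility is meant in the ring of differences \<open>S - S\<close>.  In characteristic zero, the condition
  holds whenever the elements of \<open>S\<close> are algebraic.
\<close>

locale archimedean_subsemiring = subsemiring +
  assumes divides_integer: "a \<in> S \<Longrightarrow> a \<noteq> 0 \<Longrightarrow>
    \<exists>w\<in>S. \<exists>w'\<in>S. \<exists>N\<ge>1. a * (w - w') = of_nat N"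
begin

text \<open>
  If \<open>a (w - w') = N \<ge> 1\<close> and a multiple of \<open>u\<close> dominates \<open>w x\<close>, then the same multiple of
  \<open>u a\<close> dominates \<open>a w x = N x + a w' x\<close> and hence \<open>x\<close>.
\<close>

lemma order_unit_mult:
  assumes u: "order_unit u" and a: "a \<in> S" "a \<noteq> 0"
  shows "order_unit (u * a)"
proof -
  obtain w w' N where w: "w \<in> S" "w' \<in> S" "N \<ge> 1" "a * (w - w') = of_nat N"
    using divides_integer[OF a] by blast
  have "\<exists>K. of_nat K * (u * a) - x \<in> S" if x: "x \<in> S" for x
  proof -
    obtain K where K: "of_nat K * u - w * x \<in> S"
      using u x w mult_mem unfolding order_unit_def by blast
    have "of_nat K * (u * a) - x
        = a * (of_nat K * u - w * x) + a * w' * x + (a * (w - w') - 1) * x"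
      by (simp add: algebra_simps)
    also have "\<dots> = a * (of_nat K * u - w * x) + a * w' * x + of_nat (N - 1) * x"
      using w by (simp add: of_nat_diff)
    also have "\<dots> \<in> S"
      using K w a x by (intro add_mem mult_mem of_nat_mem)
    finally show ?thesis by blast
  qed
  then show ?thesis
    using u a unfolding order_unit_def by (auto intro: mult_mem)
qed

text \<open>
  For an element \<open>d\<close> outside \<open>S\<close>, both \<open>p d\<close> and \<open>p d\<^sup>2\<close> may lie in \<open>S\<close>; then \<open>p\<close> divides the
  square of \<open>p d\<close> but not \<open>p d\<close> itself, so \<open>p\<close> is not prime.  If \<open>p f\<close> is an order unit and \<open>b\<close>
  is not dominated by \<open>f\<close>, such a \<open>d\<close> is \<open>L f - b\<close> with large \<open>L\<close>.
\<close>

lemma order_unit_cancel_prime: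
  assumes p: "p \<in> S" "p \<noteq> 0"
    and prime: "\<And>x z. x \<in> S \<Longrightarrow> x \<noteq> 0 \<Longrightarrow> z \<in> S \<Longrightarrow> x * x = p * z \<Longrightarrow> \<exists>y\<in>S. x = p * y"
    and f: "f \<in> S" "f \<noteq> 0" and pf: "order_unit (p * f)"
  shows "order_unit f"
proof (rule ccontr)
  assume "\<not> order_unit f"
  then obtain b where b: "b \<in> S" and not_above: "\<And>N. of_nat N * f - b \<notin> S"
    using f unfolding order_unit_def by blast
  obtain L1 where L1: "of_nat L1 * (p * f) - p * b \<in> S"
    using pf b p mult_mem unfolding order_unit_def by blast
  have pff: "order_unit (p * f * f)"
    using order_unit_mult[OF pf f] .
  have "2 * (f * b * p) \<in> S"
    using b f p of_nat_mem[of 2] by (auto intro!: mult_mem)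
  then obtain L2 where L2: "of_nat L2 * (p * f * f) - 2 * (f * b * p) \<in> S"
    using pff unfolding order_unit_def by blast
  \<comment> \<open>\<open>L1\<close> serves for \<open>p d \<in> S\<close> and \<open>L2\<close> for \<open>p d\<^sup>2 \<in> S\<close>; domination persists for larger multiples.\<close>
  define L where "L = max L1 L2"
  have pfS: "p * f \<in> S" and pffS: "p * f * f \<in> S"
    using p f by (auto intro: mult_mem)
  define d where "d = of_nat L * f - b"
  have "of_nat L * (p * f) - p * b \<in> S"
    using multiple_dominates_mono[OF L1 pfS] by (simp add: L_def)
  then have pd: "p * d \<in> S"
    by (simp add: d_def algebra_simps)
  have "of_nat L * (p * f * f) - 2 * (f * b * p) \<in> S"
    using multiple_dominates_mono[OF L2 pffS] by (simp add: L_def)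
  then have "of_nat L * (of_nat L * (p * f * f) - 2 * (f * b * p)) + b * b * p \<in> S"
    using b p by (intro add_mem mult_mem of_nat_mem)
  moreover have "of_nat L * (of_nat L * (p * f * f) - 2 * (f * b * p)) + b * b * p = p * d * d"
    by (simp add: d_def algebra_simps)
  ultimately have pdd: "p * d * d \<in> S" by simp
  have "d \<notin> S"
    using not_above by (simp add: d_def)
  then have "d \<noteq> 0" using zero_mem by auto
  have "\<exists>y\<in>S. p * d = p * y"
    by (rule prime[OF pd _ pdd]) (use \<open>d \<noteq> 0\<close> p in auto)
  then show False
    using p \<open>d \<notin> S\<close> by auto
qed

end

section \<open>Unique multiplicative factorization\<close>

lemma complex_subsemiring_simps [simp]:
  "carrier (complex_subsemiring S) = S"
  "x \<otimes>\<^bsub>complex_subsemiring S\<^esub> y = x * y"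
  "x \<oplus>\<^bsub>complex_subsemiring S\<^esub> y = x + y"
  "\<one>\<^bsub>complex_subsemiring S\<^esub> = 1"
  "\<zero>\<^bsub>complex_subsemiring S\<^esub> = 0"
  by (simp_all add: complex_subsemiring_def)

lemma bi_UFS_imp_subsemiring:
  assumes "bi_UFS (complex_subsemiring S)"
  shows "subsemiring S"
proof -
  interpret A: factorial_monoid "add_monoid (complex_subsemiring S)"
    using assms by (simp add: bi_UFS_def)
  interpret M: factorial_monoid "mult_of (complex_subsemiring S)"
    using assms by (simp add: bi_UFS_def)
  show ?thesis
  proof
    fix x y assume xy: "x \<in> S" "y \<in> S"
    show "x + y \<in> S" using A.m_closed[of x y] xy by simp
    show "x * y \<in> S"
      using M.m_closed[of x y] xy A.one_closed by (cases "x = 0 \<or> y = 0") auto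
  qed (use A.one_closed M.one_closed in auto)
qed

text \<open>
  The prime factors of the order unit \<open>u\<close> are cancelled from the order unit \<open>f u\<close> one by one.
\<close>

lemma order_unit_nonzero:
  fixes S :: "complex set"
  assumes arch: "archimedean_subsemiring S"
    and UF: "factorial_monoid (mult_of (complex_subsemiring S))"
    and u: "subsemiring.order_unit S u" and f: "f \<in> S" "f \<noteq> 0"
  shows "subsemiring.order_unit S f"
proof -
  interpret archimedean_subsemiring S by (fact arch)
  interpret M: factorial_monoid "mult_of (complex_subsemiring S)" by (fact UF)
  let ?M = "mult_of (complex_subsemiring S)"
  show ?thesis
  proof (cases "u = 0")
    case True
    \<comment> \<open>An order unit \<open>0\<close> makes \<open>S\<close> closed under negation, so \<open>0 f - x \<in> S\<close> for all \<open>x\<close>.\<close>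
    with u f show ?thesis by (force simp: order_unit_def intro: exI[of _ 0])
  next
    case False
    then have "u \<in> carrier ?M" using u by (simp add: order_unit_def)
    then obtain ps where ps: "set ps \<subseteq> S - {0}" "wfactors ?M ps u"
      using M.wfactors_exist by fastforce
    have peel: "order_unit f"
      if "set ps \<subseteq> S - {0}" "\<forall>p\<in>set ps. Divisibility.irreducible ?M p" "f \<in> S" "f \<noteq> 0"
        "order_unit (f * foldr (*) ps 1)" for ps f
      using that
    proof (induction ps arbitrary: f)
      case (Cons p ps)
      have p: "p \<in> S" "p \<noteq> 0" using Cons.prems by auto
      have "Divisibility.prime ?M p"
        using M.irreducible_prime[of p] Cons.prems by auto
      then have sq: "\<exists>y\<in>S. x = p * y"
        if "x \<in> S" "x \<noteq> 0" "z \<in> S" "x * x = p * z" for x z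
      proof -
        have "p divides\<^bsub>?M\<^esub> x \<otimes>\<^bsub>?M\<^esub> x"
          using that by (intro dividesI[of z]) auto
        then have "p divides\<^bsub>?M\<^esub> x"
          using \<open>Divisibility.prime ?M p\<close> M.prime_divides[of x x p] that by auto
        then show ?thesis by (auto simp: factor_def)
      qed
      have f: "f \<in> S" "f \<noteq> 0" using Cons.prems by auto
      have "f * foldr (*) (p # ps) 1 = (p * f) * foldr (*) ps 1" by (simp add: mult_ac)
      then have "order_unit ((p * f) * foldr (*) ps 1)"
        using Cons.prems(5) by (simp only:)
      moreover have "p * f \<in> S" "p * f \<noteq> 0" using p f mult_mem by auto
      moreover have "set ps \<subseteq> S - {0}" using Cons.prems(1) by simp
      moreover have "\<forall>p\<in>set ps. Divisibility.irreducible ?M p"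
        using Cons.prems(2) by (meson list.set_intros(2))
      ultimately have pf: "order_unit (p * f)"
        by (metis Cons.IH)
      show ?case
        by (rule order_unit_cancel_prime[OF p _ f pf]) (rule sq)
    qed simp
    have fold: "foldr (\<otimes>\<^bsub>?M\<^esub>) ps \<one>\<^bsub>?M\<^esub> = foldr (*) ps 1"
      by (induction ps) auto
    have "foldr (*) ps 1 \<sim>\<^bsub>?M\<^esub> u" and irr: "\<forall>p\<in>set ps. Divisibility.irreducible ?M p"
      using ps(2) fold by (auto simp: wfactors_def)
    then obtain t where t: "t \<in> S" "t \<noteq> 0" "foldr (*) ps 1 = u * t"
      by (auto simp: associated_def factor_def)
    have "order_unit (u * (f * t))"
      using f t by (intro order_unit_mult[OF u] mult_mem) auto
    moreover have "u * (f * t) = f * foldr (*) ps 1" by (simp add: t(3) mult_ac)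
    ultimately have "order_unit (f * foldr (*) ps 1)" by (simp only:)
    then show ?thesis by (rule peel[OF ps(1) irr f])
  qed
qed

section \<open>Rings and the natural numbers\<close>

lemma domain_if_minus_one_mem:
  assumes "subsemiring S" "-1 \<in> S"
  shows "domain (complex_subsemiring S)"
proof -
  interpret subsemiring S by fact
  have neg: "- x \<in> S" if "x \<in> S" for x
    using mult_mem[OF \<open>-1 \<in> S\<close> that] by simp
  have "cring (complex_subsemiring S)"
  proof (rule cringI)
    show "abelian_group (complex_subsemiring S)"
      by (rule abelian_groupI) (auto simp: add_ac zero_mem intro: add_mem bexI[OF _ neg])
    show "comm_monoid (complex_subsemiring S)"
      by (rule comm_monoidI) (auto simp: mult_ac one_mem intro: mult_mem)
  qed (simp add: algebra_simps)
  then show ?thesis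
    by (rule domain.intro) (unfold_locales; simp)
qed

text \<open>
  An additive atom \<open>a\<close> is an order unit, so every other atom \<open>q\<close> is a summand of some \<open>N a\<close>;
  atoms being prime, \<open>q\<close> is then a summand of \<open>a\<close>, hence equal to it.
\<close>

lemma eq_range_of_nat_if_all_order_units:
  fixes S :: "complex set"
  assumes "subsemiring S"
    and UF: "factorial_monoid (add_monoid (complex_subsemiring S))"
    and ou: "\<And>f. f \<in> S \<Longrightarrow> f \<noteq> 0 \<Longrightarrow> subsemiring.order_unit S f"
    and neg1: "-1 \<notin> S"
  shows "S = range of_nat"
proof -
  interpret subsemiring S by fact
  let ?A = "add_monoid (complex_subsemiring S)"
  interpret A: factorial_monoid ?A by fact
  have reduced: "x = 0" if x: "x \<in> S" "- x \<in> S" for x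
  proof (rule ccontr)
    assume "x \<noteq> 0"
    then obtain N where "of_nat N * x - 1 \<in> S"
      using ou[of x] x one_mem by (auto simp: order_unit_def)
    moreover have "of_nat N * (- x) \<in> S"
      using x by (intro mult_mem of_nat_mem)
    ultimately have "of_nat N * x - 1 + of_nat N * (- x) \<in> S"
      by (rule add_mem)
    then show False using neg1 by simp
  qed
  have Units: "Units ?A = {0}"
  proof (rule subset_antisym; rule subsetI)
    fix x assume "x \<in> Units ?A"
    then obtain y where "x \<in> S" "y \<in> S" "y + x = 0" by (auto simp: Units_def)
    moreover from this have "y = - x" by (simp add: eq_neg_iff_add_eq_0)
    ultimately show "x \<in> {0}" using reduced[of x] by simp
  qed (auto simp: Units_def zero_mem)
  have sum_list: "foldr (\<otimes>\<^bsub>?A\<^esub>) as \<one>\<^bsub>?A\<^esub> = sum_list as" for as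
    by (induction as) auto
  have atoms: "\<exists>as. set as \<subseteq> S \<and> (\<forall>a\<in>set as. Divisibility.irreducible ?A a) \<and> sum_list as = x"
    if "x \<in> S" "x \<noteq> 0" for x
  proof -
    have "x \<notin> Units ?A" using that unfolding Units by blast
    moreover have "x \<in> carrier ?A" using that by simp
    ultimately obtain as where "set as \<subseteq> carrier ?A" "factors ?A as x"
      using A.factors_exist by blast
    then have "set as \<subseteq> S" "(\<forall>a\<in>set as. Divisibility.irreducible ?A a) \<and> sum_list as = x"
      unfolding factors_def sum_list by simp_all
    then show ?thesis by blast
  qed
  have atom_nonzero: "a \<noteq> 0" if "Divisibility.irreducible ?A a" for a
    using that unfolding Divisibility.irreducible_def Units by blast
  obtain as where as: "set as \<subseteq> S" "\<forall>a\<in>set as. Divisibility.irreducible ?A a" "sum_list as = 1"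
    using atoms[OF one_mem] by auto
  then obtain a where a: "a \<in> S" "Divisibility.irreducible ?A a"
    by (cases as) auto
  have "a \<noteq> 0" using a atom_nonzero by blast
  have only_atom: "q = a"
    if q: "q \<in> S" "Divisibility.irreducible ?A q" for q
  proof -
    have qnu: "q \<noteq> 0" using q atom_nonzero by blast
    have qp: "Divisibility.prime ?A q" using A.irreducible_prime q by simp
    obtain N where N: "of_nat N * a - q \<in> S"
      using ou[OF a(1) \<open>a \<noteq> 0\<close>] q by (auto simp: order_unit_def)
    have "q divides\<^bsub>?A\<^esub> a" if "q divides\<^bsub>?A\<^esub> (of_nat M * a)" for M
      using that
    proof (induction M)
      case 0
      then obtain y where "y \<in> S" "q + y = 0" by (auto simp: factor_def)
      then have "- q \<in> S" by (simp add: add_eq_0_iff)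
      with reduced[of q] q qnu show ?case by simp
    next
      case (Suc M)
      have "of_nat (Suc M) * a = a \<otimes>\<^bsub>?A\<^esub> (of_nat M * a)"
        by (simp add: algebra_simps)
      then have "q divides\<^bsub>?A\<^esub> (a \<otimes>\<^bsub>?A\<^esub> (of_nat M * a))"
        using Suc.prems by (simp only:)
      moreover have "a \<in> carrier ?A" "of_nat M * a \<in> carrier ?A"
        using a mult_mem[OF of_nat_mem] by simp_all
      ultimately show ?case
        using Suc.IH A.prime_divides[OF _ _ qp] by blast
    qed
    moreover have "q divides\<^bsub>?A\<^esub> (of_nat N * a)"
      using N by (intro dividesI[of "of_nat N * a - q"]) auto
    ultimately have "q divides\<^bsub>?A\<^esub> a" by blast
    then have "q \<sim>\<^bsub>?A\<^esub> a"
      using divides_irreducible_condition[OF a(2), of q] q qnu unfolding Units by simp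
    then have "q divides\<^bsub>?A\<^esub> a" "a divides\<^bsub>?A\<^esub> q"
      by (simp_all only: associated_def)
    then have "\<exists>y\<in>S. a = q + y" "\<exists>z\<in>S. q = a + z"
      by (simp_all add: factor_def)
    then obtain y z where yz: "y \<in> S" "z \<in> S" "a = q + y" "q = a + z"
      by blast
    then have "q + (y + z) = q + 0" by (simp add: add.assoc)
    then have "y + z = 0" by (rule add_left_imp_eq)
    then have "z = - y" by (simp add: add_eq_0_iff)
    with yz reduced[of y] show "q = a" by simp
  qed
  have multiple: "\<exists>n. x = of_nat n * a" if "x \<in> S" for x
  proof (cases "x = 0")
    case True
    then show ?thesis by (auto intro: exI[of _ 0])
  next
    case False
    then obtain bs where bs: "set bs \<subseteq> S" "\<forall>b\<in>set bs. Divisibility.irreducible ?A b"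
      "sum_list bs = x"
      using atoms[OF \<open>x \<in> S\<close>] by blast
    have "sum_list bs = of_nat (length bs) * a"
      using bs(1,2) by (induction bs) (auto simp: only_atom algebra_simps)
    with bs show ?thesis by auto
  qed
  obtain n where n: "1 = of_nat n * a" using multiple[OF one_mem] by blast
  obtain m where "a * a = of_nat m * a" using multiple[of "a * a"] a mult_mem by blast
  then have "a = of_nat m" using \<open>a \<noteq> 0\<close> by simp
  with n have "(of_nat (n * m) :: complex) = of_nat 1" by simp
  then have "n * m = 1" by (simp only: of_nat_eq_iff)
  then have "a = 1" using \<open>a = of_nat m\<close> by simp
  with multiple show ?thesis using of_nat_mem by auto
qed

lemma semiring_isomorphic_range_of_nat:
  "semiring_isomorphic (complex_subsemiring (range of_nat)) nat_semiring"
proof -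
  define h :: "complex \<Rightarrow> nat" where "h = inv_into UNIV of_nat"
  have h: "h (of_nat n) = n" for n
    by (simp add: h_def inj_on_def)
  have "h \<in> ring_iso (complex_subsemiring (range of_nat)) nat_semiring"
    unfolding ring_iso_def
  proof (intro CollectI conjI ring_hom_memI)
    show "bij_betw h (carrier (complex_subsemiring (range of_nat))) (carrier nat_semiring)"
      by (rule bij_betw_byWitness[of _ of_nat]) (auto simp: h nat_semiring_def)
  qed (auto simp: h nat_semiring_def simp flip: of_nat_add of_nat_mult,
       use h[of 1] in simp)
  moreover have "h 0 = 0" using h[of 0] by simp
  ultimately show ?thesis
    unfolding semiring_isomorphic_def by (auto simp: nat_semiring_def)
qed

section \<open>Algebraicity of generated elements\<close>

lemma algebraic_power_eq:
  fixes x :: "'a::field_char_0"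
  assumes "Polynomial.algebraic x"
  obtains k c :: nat and d :: "nat \<Rightarrow> int"
  where "k \<ge> 1" "c \<ge> 1" "of_nat c * x ^ k = (\<Sum>j<k. of_int (d j) * x ^ j)"
proof -
  obtain p :: "int poly" where p: "p \<noteq> 0" "poly (map_poly of_int p) x = 0"
    using assms by (rule algebraicE')
  define q where "q = smult (sgn (lead_coeff p)) p"
  define k where "k = degree p"
  have q0: "(\<Sum>j\<le>k. of_int (coeff q j) * x ^ j) = 0"
  proof -
    have "0 = of_int (sgn (lead_coeff p)) * poly (map_poly of_int p) x" using p by simp
    also have "\<dots> = (\<Sum>j\<le>k. of_int (coeff q j) * x ^ j)"
      by (simp add: poly_altdef degree_map_poly coeff_map_poly q_def k_def sum_distrib_left mult_ac)
    finally show ?thesis by simp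
  qed
  have lead: "coeff q k = int (nat \<bar>lead_coeff p\<bar>)"
    by (simp add: q_def k_def sgn_if)
  have pos: "nat \<bar>lead_coeff p\<bar> \<ge> 1"
    using p by (simp add: Suc_le_eq)
  show ?thesis
  proof (rule that[of k "nat \<bar>lead_coeff p\<bar>" "\<lambda>j. - coeff q j"])
    show "k \<ge> 1"
    proof (rule ccontr)
      assume "\<not> k \<ge> 1"
      then have "k = 0" by simp
      with q0 have "of_int (coeff q k) = (0::'a)" by simp
      then have "coeff q k = 0" by simp
      with lead pos show False by simp
    qed
    have "{..k} = insert k {..<k}" by auto
    with q0 have "of_int (coeff q k) * x ^ k + (\<Sum>j<k. of_int (coeff q j) * x ^ j) = 0"
      by simp
    then have "of_int (coeff q k) * x ^ k = - (\<Sum>j<k. of_int (coeff q j) * x ^ j)"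
      by (simp only: eq_neg_iff_add_eq_0)
    then show "of_nat (nat \<bar>lead_coeff p\<bar>) * x ^ k = (\<Sum>j<k. of_int (- coeff q j) * x ^ j)"
      unfolding lead by (simp add: sum_negf)
  qed (fact pos)
qed

interpretation rat_space: vector_space "\<lambda>(q::rat) (x::'a::field_char_0). of_rat q * x"
  by unfold_locales (simp_all add: algebra_simps of_rat_add of_rat_mult)

lemma mult_span_subset:
  assumes "\<And>b. b \<in> B \<Longrightarrow> x * b \<in> rat_space.span B" and "y \<in> rat_space.span B"
  shows "x * y \<in> rat_space.span B"
proof -
  have "rat_space.subspace {y. x * y \<in> rat_space.span B}"
    unfolding rat_space.subspace_def
    by (simp add: distrib_left mult.left_commute[of x]
        rat_space.span_zero rat_space.span_add rat_space.span_scale)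
  with assms show ?thesis
    using rat_space.span_induct[of y B "\<lambda>y. x * y \<in> rat_space.span B"] by auto
qed

text \<open>
  All powers of \<open>x\<close> lie in the span of \<open>B\<close>, so more than \<open>card B\<close> of them are linearly dependent
  over the rationals.
\<close>

lemma algebraic_if_stabilizes_finite_span:
  fixes x :: "'a::field_char_0"
  assumes "finite B" "1 \<in> rat_space.span B" "\<And>b. b \<in> B \<Longrightarrow> x * b \<in> rat_space.span B"
  shows "Polynomial.algebraic x"
proof (cases "inj_on (\<lambda>k. x ^ k) {..card B}")
  case False
  then obtain i j where ij: "i \<noteq> j" "x ^ i = x ^ j" by (auto simp: inj_on_def)
  define p :: "'a poly" where "p = monom 1 i - monom 1 j"
  have "coeff p i = 1" using ij by (simp add: p_def)
  then have "p \<noteq> 0" by auto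
  moreover have "poly p x = 0" using ij by (simp add: p_def poly_monom)
  ultimately show ?thesis
    by (intro algebraicI[of p]) (auto simp: p_def)
next
  case inj: True
  let ?P = "(\<lambda>k. x ^ k) ` {..card B}"
  have "x ^ k \<in> rat_space.span B" for k
    by (induction k) (auto intro: assms mult_span_subset)
  then have "?P \<subseteq> rat_space.span B" by auto
  moreover have "card ?P = Suc (card B)" using inj by (simp add: card_image)
  ultimately have "rat_space.dependent ?P"
    using rat_space.independent_span_bound[OF \<open>finite B\<close>, of ?P] by auto
  then obtain u k where u: "k \<le> card B" "u (x ^ k) \<noteq> 0" "(\<Sum>v\<in>?P. of_rat (u v) * v) = 0"
    by (subst (asm) rat_space.dependent_finite) auto
  define p :: "'a poly" where "p = (\<Sum>k\<le>card B. monom (of_rat (u (x ^ k))) k)"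
  have coeff: "coeff p i = (if i \<le> card B then of_rat (u (x ^ i)) else 0)" for i
    by (simp add: p_def coeff_sum)
  then have "p \<noteq> 0" using u by (auto simp: poly_eq_iff)
  moreover have "poly p x = 0"
    using u(3) inj by (simp add: sum.reindex p_def poly_sum poly_monom)
  ultimately show ?thesis
    by (intro algebraicI'[of p]) (auto simp: coeff)
qed

inductive_set generated :: "'a::comm_semiring_1 set \<Rightarrow> 'a set" for A where
  gen: "a \<in> A \<Longrightarrow> a \<in> generated A"
| zero: "0 \<in> generated A"
| one: "1 \<in> generated A"
| add: "x \<in> generated A \<Longrightarrow> y \<in> generated A \<Longrightarrow> x + y \<in> generated A"
| mult: "x \<in> generated A \<Longrightarrow> y \<in> generated A \<Longrightarrow> x * y \<in> generated A"

text \<open>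
  The monomials with exponents below the degrees \<open>k i\<close> span a space that multiplication by each
  \<open>\<alpha> i\<close>, and therefore by every generated element, maps to itself.
\<close>

lemma algebraic_generated:
  fixes \<alpha> :: "'i \<Rightarrow> 'a::field_char_0"
  assumes I: "finite I" and alg: "\<And>i. i \<in> I \<Longrightarrow> Polynomial.algebraic (\<alpha> i)"
    and x: "x \<in> generated (\<alpha> ` I)"
  shows "Polynomial.algebraic x"
proof -
  have "\<forall>i\<in>I. \<exists>k c. \<exists>d :: nat \<Rightarrow> int. k \<ge> 1 \<and> c \<ge> 1 \<and>
      of_nat c * \<alpha> i ^ k = (\<Sum>j<k. of_int (d j) * \<alpha> i ^ j)"
    using alg algebraic_power_eq by metis
  then obtain k c :: "'i \<Rightarrow> nat" and d :: "'i \<Rightarrow> nat \<Rightarrow> int"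
    where k: "\<And>i. i \<in> I \<Longrightarrow> k i \<ge> 1" and c: "\<And>i. i \<in> I \<Longrightarrow> c i \<ge> 1"
      and rel: "\<And>i. i \<in> I \<Longrightarrow> of_nat (c i) * \<alpha> i ^ k i = (\<Sum>j<k i. of_int (d i j) * \<alpha> i ^ j)"
    by metis
  define m :: "('i \<Rightarrow> nat) \<Rightarrow> 'a" where "m e = (\<Prod>i\<in>I. \<alpha> i ^ e i)" for e
  define E where "E = Pi\<^sub>E I (\<lambda>i. {..<k i})"
  define B where "B = m ` E"
  have "finite B" unfolding B_def E_def using I by (intro finite_imageI finite_PiE) auto
  have m_upd: "m (e(i := n)) = \<alpha> i ^ n * (\<Prod>i\<in>I-{i}. \<alpha> i ^ e i)" if "i \<in> I" for e i n
    unfolding m_def using that I by (subst prod.remove[of I i]) (auto intro!: prod.cong)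
  have "1 = m (restrict (\<lambda>_. 0) I)" by (simp add: m_def)
  moreover have "restrict (\<lambda>_. 0) I \<in> E" using k by (force simp: E_def)
  ultimately have one: "1 \<in> rat_space.span B"
    unfolding B_def by (metis imageI rat_space.span_base)
  have stable: "\<alpha> i * b \<in> rat_space.span B" if i: "i \<in> I" and "b \<in> B" for i b
  proof -
    obtain e where e: "e \<in> E" "b = m e" using \<open>b \<in> B\<close> by (auto simp: B_def)
    define r where "r = (\<Prod>i\<in>I-{i}. \<alpha> i ^ e i)"
    have "b = \<alpha> i ^ e i * r" using m_upd[OF i, of e "e i"] e by (simp add: r_def)
    then have ab: "\<alpha> i * b = \<alpha> i ^ Suc (e i) * r" by (simp add: mult_ac)
    have low: "\<alpha> i ^ j * r \<in> rat_space.span B" if "j < k i" for j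
    proof -
      have "e(i := j) \<in> E" using e i that by (auto simp: E_def PiE_iff extensional_def)
      then have "m (e(i := j)) \<in> B" by (simp add: B_def)
      then show ?thesis using m_upd[OF i] by (simp add: r_def rat_space.span_base)
    qed
    show ?thesis
    proof (cases "Suc (e i) < k i")
      case True
      then show ?thesis using low[of "Suc (e i)"] by (simp only: ab)
    next
      case False
      moreover have "e i < k i" using e i by (auto simp: E_def PiE_iff)
      ultimately have "Suc (e i) = k i" by simp
      have ci: "of_nat (c i) \<noteq> (0::'a)" using c[OF i] by simp
      have "\<alpha> i ^ k i * r = of_rat (1 / of_nat (c i)) * (of_nat (c i) * \<alpha> i ^ k i * r)"
        using ci by (simp add: of_rat_divide)
      also have "of_nat (c i) * \<alpha> i ^ k i * r = (\<Sum>j<k i. of_rat (of_int (d i j)) * (\<alpha> i ^ j * r))"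
        by (simp add: rel[OF i] sum_distrib_right mult.assoc)
      also have "of_rat (1 / of_nat (c i)) * \<dots> \<in> rat_space.span B"
        by (intro rat_space.span_scale rat_space.span_sum low) auto
      finally show ?thesis using ab \<open>Suc (e i) = k i\<close> by simp
    qed
  qed
  have "\<forall>b\<in>B. x * b \<in> rat_space.span B"
    using x
  proof induction
    case (mult x y)
    then show ?case by (auto simp: mult.assoc intro: mult_span_subset)
  qed (auto simp: stable rat_space.span_zero rat_space.span_base distrib_right intro: rat_space.span_add)
  then show ?thesis
    using \<open>finite B\<close> one by (intro algebraic_if_stabilizes_finite_span) auto
qed

text \<open>
  For an integer polynomial with root \<open>a\<close> and nonzero constant term \<open>c\<close>, the remaining terms sum
  to \<open>-c\<close> and have \<open>a\<close> as a common factor; the cofactor is a difference of elements of \<open>S\<close>.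
\<close>

lemma algebraic_divides_integer:
  fixes S :: "'a::field_char_0 set"
  assumes "subsemiring S" and a: "a \<in> S" "a \<noteq> 0" "Polynomial.algebraic a"
  shows "\<exists>w\<in>S. \<exists>w'\<in>S. \<exists>N\<ge>1. a * (w - w') = of_nat N"
proof -
  interpret subsemiring S by fact
  obtain p :: "int poly" where p: "coeff p 0 \<noteq> 0" "poly (map_poly of_int p) a = 0"
    using algebraicE'_nonzero[OF a(3,2)] by metis
  have diff: "\<exists>w\<in>S. \<exists>w'\<in>S. poly (map_poly of_int q) a = w - w'" for q :: "int poly"
  proof (induction q)
    case (pCons c q)
    then obtain w w' where w: "w \<in> S" "w' \<in> S" "poly (map_poly of_int q) a = w - w'" by blast
    have "of_int c = (of_nat (nat c) - of_nat (nat (- c)) :: 'a)"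
      by (cases "c \<ge> 0") (simp_all add: of_nat_nat)
    then have "poly (map_poly of_int (pCons c q)) a
        = (of_nat (nat c) + a * w) - (of_nat (nat (- c)) + a * w')"
      using pCons.hyps by (simp add: map_poly_pCons w(3) algebra_simps)
    moreover have "of_nat (nat c) + a * w \<in> S" "of_nat (nat (- c)) + a * w' \<in> S"
      using a w by (auto intro: add_mem mult_mem of_nat_mem)
    ultimately show ?case by blast
  qed (use zero_mem in force)
  obtain c q where q: "p = pCons c q" by (cases p)
  obtain w w' where w: "w \<in> S" "w' \<in> S" "poly (map_poly of_int q) a = w - w'"
    using diff by blast
  have c: "c \<noteq> 0" using p q by simp
  have "of_int c + a * (w - w') = 0"
    using p q c w(3) by (simp add: map_poly_pCons)
  then have eq: "a * (w - w') = of_int (- c)" "a * (w' - w) = of_int c"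
    by (simp_all add: eq_neg_iff_add_eq_0 algebra_simps)
  show ?thesis
  proof (cases "c < 0")
    case True
    then have "a * (w - w') = of_nat (nat (- c))" using eq(1) by (simp add: of_nat_nat)
    moreover have "nat (- c) \<ge> 1" using True by simp
    ultimately show ?thesis using w by blast
  next
    case False
    then have "a * (w' - w) = of_nat (nat c)" using eq(2) by (simp add: of_nat_nat)
    moreover have "nat c \<ge> 1" using False c by simp
    ultimately show ?thesis using w by blast
  qed
qed

section \<open>Existence of an order unit\<close>

text \<open>
  Coefficients of either sign do no harm: they are raised to nonnegative ones by adding a multiple
  of all lower powers at once.
\<close>

lemma (in subsemiring) power_dominated:
  fixes c :: nat
  assumes x: "x \<in> S" and "c \<ge> 1" and rel: "of_nat c * x ^ k = (\<Sum>j<k. of_int (d j) * x ^ j)"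
  shows "\<exists>N. of_nat N * (\<Sum>j<k. x ^ j) - x ^ k \<in> S"
proof -
  define N where "N = (\<Sum>j<k. nat \<bar>d j\<bar>)"
  have dN: "d j \<le> int N" if "j < k" for j
  proof -
    have "nat \<bar>d j\<bar> \<le> N" unfolding N_def using that by (intro member_le_sum) auto
    then show ?thesis by linarith
  qed
  have "of_nat N * (\<Sum>j<k. x ^ j) - x ^ k
      = (of_nat N * (\<Sum>j<k. x ^ j) - of_nat c * x ^ k) + of_nat (c - 1) * x ^ k"
    using \<open>c \<ge> 1\<close> by (simp add: of_nat_diff algebra_simps)
  also have "of_nat N * (\<Sum>j<k. x ^ j) - of_nat c * x ^ k = (\<Sum>j<k. of_int (int N - d j) * x ^ j)"
    by (simp add: rel sum_distrib_left algebra_simps sum_subtractf)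
  also have "\<dots> = (\<Sum>j<k. of_nat (nat (int N - d j)) * x ^ j)"
    using dN by (intro sum.cong) (simp_all add: of_nat_nat)
  finally show ?thesis
    using x by (auto intro!: exI[of _ N] add_mem sum_mem mult_mem of_nat_mem power_mem)
qed

lemma generated_subset:
  assumes "subsemiring S" "A \<subseteq> S"
  shows "generated A \<subseteq> S"
proof
  interpret subsemiring S by fact
  fix x assume "x \<in> generated A"
  then show "x \<in> S"
    by induction (use \<open>A \<subseteq> S\<close> in \<open>auto intro: zero_mem one_mem add_mem mult_mem\<close>)
qed

lemma subsemiring_generated: "subsemiring (generated A)"
  by unfold_locales (auto intro: generated.intros)

text \<open>
  Closure under the operations can be assumed, since it is part of what unique factorization in
  the additive and multiplicative monoids means; no products of polynomials have to be computed.
\<close>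

lemma N0_adjoin_eq_generated:
  assumes "subsemiring (N0_adjoin n \<alpha>)"
  shows "N0_adjoin n \<alpha> = generated (\<alpha> ` {1..n})"
proof (intro subset_antisym subsetI)
  interpret subsemiring "generated (\<alpha> ` {1..n})"
    by (rule subsemiring_generated)
  fix x assume "x \<in> N0_adjoin n \<alpha>"
  then obtain f where f: "x = mpoly_eval \<alpha> f" "mpoly_vars f \<subseteq> {1..n}"
    by (auto simp: N0_adjoin_def)
  show "x \<in> generated (\<alpha> ` {1..n})"
    unfolding f(1) mpoly_eval_def
    using f(2) by (intro sum_mem mult_mem of_nat_mem prod_mem power_mem generated.gen)
      (auto simp: mpoly_vars_def)
next
  have "\<alpha> i \<in> N0_adjoin n \<alpha>" if "i \<in> {1..n}" for i
  proof -
    define f :: nat_mpoly where "f = Poly_Mapping.single (Poly_Mapping.single i 1) 1"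
    have "mpoly_vars f \<subseteq> {1..n}" "\<alpha> i = mpoly_eval \<alpha> f"
      using that by (simp_all add: f_def mpoly_vars_def mpoly_eval_def)
    then show ?thesis unfolding N0_adjoin_def by blast
  qed
  then show "x \<in> N0_adjoin n \<alpha>" if "x \<in> generated (\<alpha> ` {1..n})" for x
    using generated_subset[OF assms, of "\<alpha> ` {1..n}"] that by blast
qed

text \<open>
  With \<open>k i\<close> the degree of an equation for \<open>\<alpha> i\<close>, the order unit is
  \<open>u = (\<Prod>i\<in>I. 1 + \<alpha> i + \<dots> + \<alpha> i ^ (k i - 1))\<close>.  Multiplying the factor of \<open>i\<close> by \<open>\<alpha> i\<close>
  shifts its summands and produces a single new one, \<open>\<alpha> i ^ k i\<close>, which a multiple of the factor
  dominates.  The elements \<open>x\<close> with \<open>x u \<sqsubseteq> u\<close> thus include the generators and form a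
  subsemiring, hence are all of \<open>S\<close>; finally \<open>x \<sqsubseteq> x u\<close>, since \<open>u - 1 \<in> S\<close>.
\<close>

lemma ex_order_unit:
  assumes I: "finite I" and alg: "\<And>i. i \<in> I \<Longrightarrow> Polynomial.algebraic (\<alpha> i)"
  shows "\<exists>u. subsemiring.order_unit (generated (\<alpha> ` I)) u"
proof -
  interpret subsemiring "generated (\<alpha> ` I)" by (rule subsemiring_generated)
  let ?S = "generated (\<alpha> ` I)"
  have mem: "\<alpha> i \<in> ?S" if "i \<in> I" for i using that by (auto intro: generated.gen)
  have "\<exists>k N. k \<ge> 1 \<and> of_nat N * (\<Sum>j<k. \<alpha> i ^ j) - \<alpha> i ^ k \<in> ?S" if i: "i \<in> I" for i
  proof -
    obtain k c :: nat and d :: "nat \<Rightarrow> int"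
      where "k \<ge> 1" "c \<ge> 1" "of_nat c * \<alpha> i ^ k = (\<Sum>j<k. of_int (d j) * \<alpha> i ^ j)"
      using algebraic_power_eq[OF alg[OF i]] by metis
    then show ?thesis using power_dominated[OF mem[OF i]] by blast
  qed
  then obtain k N where k: "\<And>i. i \<in> I \<Longrightarrow> k i \<ge> 1"
    and N: "\<And>i. i \<in> I \<Longrightarrow> of_nat (N i) * (\<Sum>j<k i. \<alpha> i ^ j) - \<alpha> i ^ k i \<in> ?S"
    by metis
  define v where "v i = (\<Sum>j<k i. \<alpha> i ^ j)" for i
  define u where "u = (\<Prod>i\<in>I. v i)"
  have v_mem: "v i \<in> ?S" if "i \<in> I" for i
    unfolding v_def using mem[OF that] by (intro sum_mem power_mem)
  have u_mem: "u \<in> ?S" unfolding u_def by (intro prod_mem v_mem)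
  have v_split: "v i = 1 + (\<Sum>j\<in>{1..<k i}. \<alpha> i ^ j)" if "i \<in> I" for i
  proof -
    have "{..<k i} = insert 0 {1..<k i}" using k[OF that] by auto
    then show ?thesis by (simp add: v_def)
  qed
  have "(\<Prod>i\<in>J. v i) - 1 \<in> ?S" if "J \<subseteq> I" for J
    using finite_subset[OF that I] that
  proof (induction J rule: finite_induct)
    case (insert i J)
    have "(\<Prod>i\<in>insert i J. v i) - 1
        = v i * ((\<Prod>i\<in>J. v i) - 1) + (\<Sum>j\<in>{1..<k i}. \<alpha> i ^ j)"
      using insert v_split[of i] by (simp add: algebra_simps)
    also have "\<dots> \<in> ?S"
      using insert mem v_mem by (intro add_mem mult_mem sum_mem power_mem) auto
    finally show ?case .
  qed (simp add: zero_mem)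
  then have u1: "u - 1 \<in> ?S" by (simp add: u_def)
  have stable: "\<exists>M. of_nat M * u - x * u \<in> ?S" if "x \<in> ?S" for x
    using that
  proof induction
    case (gen a)
    then obtain i where i: "i \<in> I" "a = \<alpha> i" by auto
    have shift: "\<alpha> i * v i + 1 = v i + \<alpha> i ^ k i"
    proof -
      have "\<alpha> i * v i = (\<Sum>j<k i. \<alpha> i ^ Suc j)"
        by (simp add: v_def sum_distrib_left)
      then have "\<alpha> i * v i + 1 = (\<Sum>j<Suc (k i). \<alpha> i ^ j)"
        by (subst sum.lessThan_Suc_shift) simp
      then show ?thesis by (simp add: v_def)
    qed
    define r where "r = (\<Prod>i\<in>I-{i}. v i)"
    have ur: "u = v i * r" unfolding u_def r_def using I i by (simp add: prod.remove)
    have r_mem: "r \<in> ?S" unfolding r_def by (intro prod_mem v_mem) auto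
    have "\<alpha> i * v i = v i + \<alpha> i ^ k i - 1" using shift by (simp add: eq_diff_eq)
    then have "of_nat (Suc (N i)) * u - a * u
        = of_nat (Suc (N i)) * (v i * r) - (v i + \<alpha> i ^ k i - 1) * r"
      by (simp only: ur i(2) mult.assoc[symmetric])
    also have "\<dots> = ((of_nat (N i) * v i - \<alpha> i ^ k i) + 1) * r"
      by (simp add: algebra_simps)
    also have "\<dots> \<in> ?S"
      using N[OF i(1)] r_mem by (intro add_mem mult_mem one_mem) (simp_all add: v_def)
    finally show ?case by blast
  next
    case (add x y)
    then obtain M K where "of_nat M * u - x * u \<in> ?S" "of_nat K * u - y * u \<in> ?S" by blast
    then have "(of_nat M * u - x * u) + (of_nat K * u - y * u) \<in> ?S" by (rule add_mem)
    then show ?case by (intro exI[of _ "M + K"]) (simp add: algebra_simps)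
  next
    case (mult x y)
    then obtain M K where MK: "of_nat M * u - x * u \<in> ?S" "of_nat K * u - y * u \<in> ?S" by blast
    then have "of_nat K * (of_nat M * u - x * u) + x * (of_nat K * u - y * u) \<in> ?S"
      using mult.hyps by (intro add_mem mult_mem of_nat_mem)
    then show ?case by (intro exI[of _ "K * M"]) (simp add: algebra_simps)
  qed (auto intro: exI[of _ 0] exI[of _ 1] simp: zero_mem)
  have "\<exists>M. of_nat M * u - x \<in> ?S" if x: "x \<in> ?S" for x
  proof -
    obtain M where "of_nat M * u - x * u \<in> ?S" using stable[OF x] by blast
    then have "(of_nat M * u - x * u) + x * (u - 1) \<in> ?S"
      using x u1 by (intro add_mem mult_mem)
    then show ?thesis by (auto simp: algebra_simps)
  qed
  with u_mem show ?thesis by (auto simp: order_unit_def)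
qed

section \<open>The classification\<close>

theorem mainTheorem4:
  fixes n :: nat and \<alpha> :: "nat \<Rightarrow> complex" and S :: "complex set"
  assumes "n \<ge> 1"
    and "\<forall>i\<in>{1..n}. Polynomial.algebraic (\<alpha> i)"
    and "S = N0_adjoin n \<alpha>"
    and "bi_UFS (complex_subsemiring S)"
  shows "domain (complex_subsemiring S) \<or>
         semiring_isomorphic (complex_subsemiring S) nat_semiring"
proof -
  have sub: "subsemiring S"
    using assms(4) by (rule bi_UFS_imp_subsemiring)
  then have S: "S = generated (\<alpha> ` {1..n})"
    using N0_adjoin_eq_generated assms(3) by simp
  have "Polynomial.algebraic x" if "x \<in> S" for x
    using algebraic_generated[of "{1..n}" \<alpha> x] assms(2) that S by auto
  then have arch: "archimedean_subsemiring S"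
    using algebraic_divides_integer[OF sub] sub
    by (auto simp: archimedean_subsemiring_def archimedean_subsemiring_axioms_def)
  obtain u where u: "subsemiring.order_unit S u"
    using ex_order_unit[of "{1..n}" \<alpha>] assms(2) S by auto
  have units: "subsemiring.order_unit S f" if "f \<in> S" "f \<noteq> 0" for f
    using order_unit_nonzero[OF arch _ u that] assms(4) by (simp add: bi_UFS_def)
  show ?thesis
  proof (cases "-1 \<in> S")
    case True
    then show ?thesis using domain_if_minus_one_mem[OF sub] by blast
  next
    case False
    have "S = range of_nat"
      using eq_range_of_nat_if_all_order_units[OF sub _ units False] assms(4)
      by (simp add: bi_UFS_def)
    then show ?thesis using semiring_isomorphic_range_of_nat by simp
  qed
qed

end
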